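(* The class of permutations sortable by two pop stacks in parallel with a bypass is $$\mathrm{Av}(2341,25314,42513,42531,45213,45231,52314,642135,642153).$$
   Context: $\mathrm{Av}(T)$ is the set of permutations, of all sizes, avoiding (in the classical sense) every pattern in $T$. The sorting machine consists of two pop stacks $S_1,S_2$ in parallel with a bypass. The entries of an input permutation $\pi=\pi_1\cdots\pi_n$ are processed from left to right, both stacks being initially empty. At any time the allowed operations are: push the next input entry on top of $S_1$ or on top of $S_2$; pop $S_j$ ($j\in\{1,2\}$), i.e. remove all the elements of $S_j$ and append them, from top to bottom, to the right end of the output; bypass, i.e. append the next input entry directly to the right end of the output. The permutation $\pi$ is sortable by this machine if some sequence of these operations that processes all entries and empties both stacks produces the output $12\cdots n$. *)

theory Defs
  imports Main "HOL-Library.Sublist"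
begin

text \<open>
  A permutation of size \<open>n\<close> is given by its one-line notation, a list of length \<open>n\<close> containing
  each of \<open>1, \<dots>, n\<close> exactly once; the empty permutation is included.
\<close>

definition is_perm :: "nat list \<Rightarrow> bool" where
  "is_perm p \<longleftrightarrow> distinct p \<and> set p = {1..length p}"

definition order_isomorphic :: "nat list \<Rightarrow> nat list \<Rightarrow> bool" where
  "order_isomorphic xs ys \<longleftrightarrow> length xs = length ys \<and>
     (\<forall>i < length xs. \<forall>j < length xs. xs ! i < xs ! j \<longleftrightarrow> ys ! i < ys ! j)"

text \<open>Below, \<^const>\<open>subseq\<close> is the (not necessarily contiguous) subsequence relation.\<close>

definition contains_pattern :: "nat list \<Rightarrow> nat list \<Rightarrow> bool" where
  "contains_pattern p t \<longleftrightarrow> (\<exists>xs. subseq xs p \<and> order_isomorphic xs t)"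

definition Av :: "nat list set \<Rightarrow> nat list set" where
  "Av T = {p. is_perm p \<and> (\<forall>t \<in> T. \<not> contains_pattern p t)}"

text \<open>
  A state consists of the remaining input (next entry first), the stacks \<open>S\<^sub>1\<close> and \<open>S\<^sub>2\<close> (top entry
  first) and the output (left to right).  Popping an empty stack is permitted and has no effect.
\<close>

type_synonym state = "nat list \<times> nat list \<times> nat list \<times> nat list"

inductive step :: "state \<Rightarrow> state \<Rightarrow> bool" where
  push1:  "step (x # inp, s1, s2, out) (inp, x # s1, s2, out)"
| push2:  "step (x # inp, s1, s2, out) (inp, s1, x # s2, out)"
| pop1:   "step (inp, s1, s2, out) (inp, [], s2, out @ s1)"
| pop2:   "step (inp, s1, s2, out) (inp, s1, [], out @ s2)"
| bypass: "step (x # inp, s1, s2, out) (inp, s1, s2, out @ [x])"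

definition sortable :: "nat list \<Rightarrow> bool" where
  "sortable p \<longleftrightarrow> step\<^sup>*\<^sup>* (p, [], [], []) ([], [], [], [1..<Suc (length p)])"

end

theory Submission
  imports Defs
begin

text \<open>
  A pop outputs an increasing run of consecutive values, so the output is cut into intervals of
  values, each of which occurs in decreasing order in the input.  Enlarging these intervals never
  hurts: if \<open>v + 1\<close> precedes \<open>v\<close>, keeping both in one stack occupies the stack no longer than
  holding \<open>v + 1\<close> alone.  With maximal intervals the machine fails exactly when three entries from
  different intervals have to wait for a smaller entry \<open>c\<close>.  Two values \<open>y < z\<close> lie in different
  maximal intervals iff some ascent of the permutation has both values in \<open>[y, z]\<close>.  A case
  analysis on the relative positions of the three waiting entries and the two ascents yields the
  nine patterns.
\<close>

section \<open>Obstructions\<close>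

definition ascent_between :: "nat list \<Rightarrow> nat \<Rightarrow> nat \<Rightarrow> bool" where
  "ascent_between p y z \<longleftrightarrow>
     (\<exists>u v. u < v \<and> v < length p \<and> y \<le> p ! u \<and> p ! u < p ! v \<and> p ! v \<le> z)"

text \<open>The variables \<open>c\<close>, \<open>i\<close>, \<open>j\<close>, \<open>k\<close> are positions, whereas \<^const>\<open>ascent_between\<close> takes values.\<close>

definition obstruction :: "nat list \<Rightarrow> bool" where
  "obstruction p \<longleftrightarrow> (\<exists>c i j k. i < c \<and> j < c \<and> k < c \<and> c < length p \<and> p ! c < p ! i \<and>
     ascent_between p (p ! i) (p ! j) \<and> ascent_between p (p ! j) (p ! k))"

lemma ascent_between_less: "ascent_between p y z \<Longrightarrow> y < z"
  unfolding ascent_between_def by force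

section \<open>Occurrences of patterns as lists of positions\<close>

lemma subseq_indices:
  assumes "subseq xs ys"
  obtains g where "strict_mono_on {..<length xs} g"
    and "\<And>i. i < length xs \<Longrightarrow> g i < length ys" and "\<And>i. i < length xs \<Longrightarrow> ys ! g i = xs ! i"
proof -
  have "\<exists>g. strict_mono_on {..<length xs} g \<and> (\<forall>i < length xs. g i < length ys \<and> ys ! g i = xs ! i)"
    using assms
  proof (induction rule: list_emb.induct)
    case (list_emb_Nil ys)
    then show ?case by (simp add: strict_mono_on_def)
  next
    case (list_emb_Cons xs ys y)
    then obtain g where g: "strict_mono_on {..<length xs} g"
      "\<forall>i < length xs. g i < length ys \<and> ys ! g i = xs ! i" by blast
    show ?case
      by (rule exI[of _ "Suc \<circ> g"]) (use g in \<open>auto simp: strict_mono_on_def\<close>)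
  next
    case (list_emb_Cons2 x y xs ys)
    then obtain g where g: "strict_mono_on {..<length xs} g"
      "\<forall>i < length xs. g i < length ys \<and> ys ! g i = xs ! i" by blast
    show ?case
      by (rule exI[of _ "\<lambda>i. case i of 0 \<Rightarrow> 0 | Suc j \<Rightarrow> Suc (g j)"])
        (use g list_emb_Cons2 in \<open>auto simp: strict_mono_on_def nth_Cons split: nat.splits\<close>)
  qed
  then show ?thesis using that by auto
qed

lemma subseq_map_nth:
  assumes "sorted_wrt (<) is" and "\<forall>i \<in> set is. i < length p"
  shows "subseq (map ((!) p) is) p"
proof -
  \<comment> \<open>A strictly increasing list is determined by its set, so \<open>is\<close> equals
    the list of all positions filtered by membership in \<open>set is\<close>; filtering yields a
    subsequence.\<close>
  have "map ((!) p) is = map ((!) p) (filter (\<lambda>i. i \<in> set is) [0..<length p])"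
    by (rule arg_cong[where f = "map ((!) p)"])
      (rule sorted_distinct_set_unique,
        use assms in \<open>auto simp: strict_sorted_iff intro: sorted_filter[of id, simplified]\<close>)
  also have "subseq \<dots> (map ((!) p) [0..<length p])"
    by (intro subseq_map subseq_filter_left)
  finally show ?thesis by (simp add: map_nth)
qed

lemma contains_patternI:
  assumes "sorted_wrt (<) is" and "\<forall>i \<in> set is. i < length p"
    and "order_isomorphic (map ((!) p) is) t"
  shows "contains_pattern p t"
  unfolding contains_pattern_def using assms subseq_map_nth by blast

section \<open>Obstructions and the nine patterns\<close>

text \<open>An obstruction speaks only of the order of positions and of comparisons between entries,
  and the embedding \<open>g\<close> of an occurrence of \<open>t\<close> respects both.\<close>

lemma obstruction_mono:
  assumes "contains_pattern p t" and "obstruction t"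
  shows "obstruction p"
proof -
  obtain xs where xs: "subseq xs p" "order_isomorphic xs t"
    using assms(1) unfolding contains_pattern_def by blast
  obtain g where g: "strict_mono_on {..<length xs} g"
    and gl: "\<And>i. i < length xs \<Longrightarrow> g i < length p" and gx: "\<And>i. i < length xs \<Longrightarrow> p ! g i = xs ! i"
    using subseq_indices[OF xs(1)] by metis
  have len: "length t = length xs"
    using xs(2) by (simp add: order_isomorphic_def)
  have less: "p ! g i < p ! g j \<longleftrightarrow> t ! i < t ! j" if "i < length t" "j < length t" for i j
    using that xs(2) gx by (simp add: order_isomorphic_def)
  have le: "p ! g i \<le> p ! g j \<longleftrightarrow> t ! i \<le> t ! j" if "i < length t" "j < length t" for i j
    using less[OF that(2,1)] by (simp add: not_less[symmetric])
  have mono: "g i < g j" if "i < j" "j < length t" for i j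
    using that g len by (auto simp: strict_mono_on_def)
  have asc: "ascent_between p (p ! g i) (p ! g j)"
    if asc_t: "ascent_between t (t ! i) (t ! j)" and ij: "i < length t" "j < length t" for i j
  proof -
    obtain u v where "u < v" "v < length t" "t ! i \<le> t ! u" "t ! u < t ! v" "t ! v \<le> t ! j"
      using asc_t unfolding ascent_between_def by blast
    then show ?thesis
      unfolding ascent_between_def using ij less le mono gl len
      by (intro exI[of _ "g u"] exI[of _ "g v"]) simp
  qed
  obtain c i j k where "i < c" "j < c" "k < c" "c < length t" "t ! c < t ! i"
     "ascent_between t (t ! i) (t ! j)" "ascent_between t (t ! j) (t ! k)"
    using assms(2) unfolding obstruction_def by blast
  then show ?thesis
    unfolding obstruction_def using asc less mono gl len
    by (intro exI[of _ "g c"] exI[of _ "g i"] exI[of _ "g j"] exI[of _ "g k"]) simp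
qed

text \<open>The larger value \<open>p ! j\<close> comes first, so the two positions do not form the
  ascent themselves. If its upper end lies after \<open>i\<close>, its lower end can be moved to
  \<open>i\<close>; if its lower end lies before \<open>j\<close>, its upper end can be moved to
  \<open>j\<close>; otherwise both ends are strictly inside. This keeps the number of new points in
  the case analysis small.\<close>

lemma ascent_betweenD:
  assumes "distinct p" and "ascent_between p (p ! i) (p ! j)" and "i < length p" and "j < i"
  shows "(\<exists>v > i. v < length p \<and> p ! i < p ! v \<and> p ! v < p ! j) \<or>
    (\<exists>u < j. p ! i < p ! u \<and> p ! u < p ! j) \<or>
    (\<exists>u v. j < u \<and> u < v \<and> v < i \<and> p ! i < p ! u \<and> p ! u < p ! v \<and> p ! v < p ! j)"
proof -
  obtain u v where uv: "u < v" "v < length p" "p ! i \<le> p ! u" "p ! u < p ! v" "p ! v \<le> p ! j"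
    using assms(2) unfolding ascent_between_def by blast
  have "p ! u = p ! i \<longleftrightarrow> u = i" "p ! v = p ! j \<longleftrightarrow> v = j"
    using uv assms by (auto simp: nth_eq_iff_index_eq)
  then consider "v > i" "v \<noteq> j" | "u < j" "u \<noteq> i" | "j < u" "v < i" "v \<noteq> j"
    using uv assms(4) by fastforce
  then show ?thesis
    using uv \<open>p ! u = p ! i \<longleftrightarrow> u = i\<close> \<open>p ! v = p ! j \<longleftrightarrow> v = j\<close>
    by cases (metis dual_order.strict_trans1 dual_order.strict_trans2 le_neq_implies_less less_irrefl)+
qed

text \<open>The nine patterns are spelled out as relations between positions and values. Once the
  relative order of the points of the obstruction and of its ascents is fixed, an instance of one
  pattern closes the case.\<close>

lemma no_obstruction_if_avoids:
  fixes p :: "nat list"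
  assumes distinct: "distinct p" and "obstruction p"
    and av2341: "\<And>a b c d. \<not> (a < b \<and> b < c \<and> c < d \<and> d < length p \<and>
      p ! d < p ! a \<and> p ! a < p ! b \<and> p ! b < p ! c)"
    and av25314: "\<And>a b c d e. \<not> (a < b \<and> b < c \<and> c < d \<and> d < e \<and> e < length p \<and>
      p ! d < p ! a \<and> p ! a < p ! c \<and> p ! c < p ! e \<and> p ! e < p ! b)"
    and av42513: "\<And>a b c d e. \<not> (a < b \<and> b < c \<and> c < d \<and> d < e \<and> e < length p \<and>
      p ! d < p ! b \<and> p ! b < p ! e \<and> p ! e < p ! a \<and> p ! a < p ! c)"
    and av42531: "\<And>a b c d e. \<not> (a < b \<and> b < c \<and> c < d \<and> d < e \<and> e < length p \<and>
      p ! e < p ! b \<and> p ! b < p ! d \<and> p ! d < p ! a \<and> p ! a < p ! c)"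
    and av45213: "\<And>a b c d e. \<not> (a < b \<and> b < c \<and> c < d \<and> d < e \<and> e < length p \<and>
      p ! d < p ! c \<and> p ! c < p ! e \<and> p ! e < p ! a \<and> p ! a < p ! b)"
    and av45231: "\<And>a b c d e. \<not> (a < b \<and> b < c \<and> c < d \<and> d < e \<and> e < length p \<and>
      p ! e < p ! c \<and> p ! c < p ! d \<and> p ! d < p ! a \<and> p ! a < p ! b)"
    and av52314: "\<And>a b c d e. \<not> (a < b \<and> b < c \<and> c < d \<and> d < e \<and> e < length p \<and>
      p ! d < p ! b \<and> p ! b < p ! c \<and> p ! c < p ! e \<and> p ! e < p ! a)"
    and av642135: "\<And>a b c d e f. \<not> (a < b \<and> b < c \<and> c < d \<and> d < e \<and> e < f \<and>
      f < length p \<and> p ! d < p ! c \<and> p ! c < p ! e \<and> p ! e < p ! b \<and> p ! b < p ! f \<and>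
      p ! f < p ! a)"
    and av642153: "\<And>a b c d e f. \<not> (a < b \<and> b < c \<and> c < d \<and> d < e \<and> e < f \<and>
      f < length p \<and> p ! d < p ! c \<and> p ! c < p ! f \<and> p ! f < p ! b \<and> p ! b < p ! e \<and>
      p ! e < p ! a)"
  shows False
proof -
  obtain c x y z where less_c: "x < c" "y < c" "z < c" "c < length p" and cx: "p ! c < p ! x"
    and xy: "ascent_between p (p ! x) (p ! y)" and yz: "ascent_between p (p ! y) (p ! z)"
    using assms(2) unfolding obstruction_def by blast
  note order = less_c cx ascent_between_less[OF xy] ascent_between_less[OF yz]
  have len: "x < length p" "y < length p" "z < length p"
    using less_c by simp_all
  \<comment> \<open>Different values sit at different positions; in this form \<open>auto\<close>
    can split on which of two points comes first.\<close>
  have neq: "p ! i < p ! j \<longrightarrow> i < j \<or> j < i" for i j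
    by (metis less_irrefl nat_neq_iff)
  have "x \<noteq> y" "y \<noteq> z" "x \<noteq> z"
    using order by auto
  \<comment> \<open>The case names list the positions from left to right, whereas
    \<open>p ! x < p ! y < p ! z\<close>. Of the pairs \<open>x\<close>, \<open>y\<close> and
    \<open>y\<close>, \<open>z\<close>, one that is increasing in position is its own ascent, so
    \<open>ascent_betweenD\<close> is applied only to a pair whose larger value comes first, and to
    both pairs only in \<open>zyx\<close>.\<close>
  then consider (xyz) "x < y" "y < z" | (xzy) "x < z" "z < y" | (yxz) "y < x" "x < z"
    | (yzx) "y < z" "z < x" | (zxy) "z < x" "x < y" | (zyx) "z < y" "y < x"
    by linarith
  then show False
  proof cases
    case xyz
    then show ?thesis
      using av2341[of x y z c] order by blast
  next
    case xzy
    from ascent_betweenD[OF distinct yz len(2) xzy(2)] show ?thesis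
    proof (elim disjE exE conjE)
      fix v assume "y < v" "v < length p" "p ! y < p ! v" "p ! v < p ! z"
      with xzy order show False
        using av2341[of x y v c] av25314[of x z y c v] neq[of c v] by auto
    next
      fix u assume "u < z" "p ! y < p ! u" "p ! u < p ! z"
      with xzy order show False
        using av2341[of x u z c] av42531[of u x z y c] neq[of x u] by auto
    next
      fix u v assume "z < u" "u < v" "v < y" "p ! y < p ! u" "p ! u < p ! v" "p ! v < p ! z"
      with xzy order show False
        using av2341[of x u v c] by auto
    qed
  next
    case yxz
    from ascent_betweenD[OF distinct xy len(1) yxz(1)] show ?thesis
    proof (elim disjE exE conjE)
      fix v assume "x < v" "v < length p" "p ! x < p ! v" "p ! v < p ! y"
      with yxz order show False
        using av2341[of x v z c] av42531[of y x z v c] av42513[of y x z c v] neq[of v z] neq[of c v] by auto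
    next
      fix u assume "u < y" "p ! x < p ! u" "p ! u < p ! y"
      with yxz order show False
        using av2341[of u y z c] by auto
    next
      fix u v assume "y < u" "u < v" "v < x" "p ! x < p ! u" "p ! u < p ! v" "p ! v < p ! y"
      with yxz order show False
        using av2341[of u v z c] by auto
    qed
  next
    case yzx
    then have "y < x" by simp
    from ascent_betweenD[OF distinct xy len(1) this] show ?thesis
    proof (elim disjE exE conjE)
      fix v assume "x < v" "v < length p" "p ! x < p ! v" "p ! v < p ! y"
      with yzx order show False
        using av45231[of y z x v c] av45213[of y z x c v] neq[of c v] by auto
    next
      fix u assume "u < y" "p ! x < p ! u" "p ! u < p ! y"
      with yzx order show False
        using av2341[of u y z c] by auto
    next
      fix u v assume "y < u" "u < v" "v < x" "p ! x < p ! u" "p ! u < p ! v" "p ! v < p ! y"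
      with yzx order show False
        using av2341[of u v z c] av45231[of y z u v c] av42531[of y u z v c] neq[of u z] neq[of v z] by auto
    qed
  next
    case zxy
    then have "z < y" by simp
    from ascent_betweenD[OF distinct yz len(2) this] show ?thesis
    proof (elim disjE exE conjE)
      fix v assume "y < v" "v < length p" "p ! y < p ! v" "p ! v < p ! z"
      with zxy order show False
        using av2341[of x y v c] av52314[of z x y c v] neq[of c v] by auto
    next
      fix u assume "u < z" "p ! y < p ! u" "p ! u < p ! z"
      with zxy order show False
        using av45231[of u z x y c] by auto
    next
      fix u v assume "z < u" "u < v" "v < y" "p ! y < p ! u" "p ! u < p ! v" "p ! v < p ! z"
      with zxy order show False
        using av2341[of x u v c] av42531[of u x v y c] av45231[of u v x y c] neq[of x u] neq[of x v] by auto
    qed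
  next
    case zyx
    from ascent_betweenD[OF distinct xy len(1) zyx(2)] show ?thesis
    proof (elim disjE exE conjE)
      fix v assume v: "x < v" "v < length p" "p ! x < p ! v" "p ! v < p ! y"
      from ascent_betweenD[OF distinct yz len(2) zyx(1)] show False
      proof (elim disjE exE conjE)
        \<comment> \<open>If \<open>v\<close> and \<open>w\<close> both come after \<open>c\<close>,
          then \<open>z\<close>, \<open>y\<close>, \<open>x\<close>, \<open>c\<close> and these two
          form 642135 or 642153, depending on which of \<open>v\<close>, \<open>w\<close> comes
          first. All other placements already give a pattern of length four or five.\<close>
        fix w assume w: "y < w" "w < length p" "p ! y < p ! w" "p ! w < p ! z"
        with v zyx order show False
          using av45231[of y w x v c] av45213[of y w x c v] av642135[of z y x c v w]
            av52314[of z x v c w] av2341[of x v w c] av642153[of z y x c w v]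
            av42513[of y x w c v] av42531[of y x w v c] neq[of x w] neq[of c w] neq[of v w] neq[of c v]
          by auto
      next
        fix w assume "w < z" "p ! y < p ! w" "p ! w < p ! z"
        with v zyx order show False
          using av45231[of w z x v c] av45213[of w z x c v] neq[of c v] by auto
      next
        fix w t assume "z < w" "w < t" "t < y" "p ! y < p ! w" "p ! w < p ! t" "p ! t < p ! z"
        with v zyx order show False
          using av45231[of w t x v c] av45213[of w t x c v] neq[of c v] by auto
      qed
    next
      fix u assume u: "u < y" "p ! x < p ! u" "p ! u < p ! y"
      from ascent_betweenD[OF distinct yz len(2) zyx(1)] show False
      proof (elim disjE exE conjE)
        fix w assume w: "y < w" "w < length p" "p ! y < p ! w" "p ! w < p ! z"
        with u zyx order show False
          using av2341[of u y w c] av25314[of u z y c w] av52314[of z u y c w] neq[of c w] neq[of u z] by auto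
      next
        fix w assume "w < z" "p ! y < p ! w" "p ! w < p ! z"
        with u zyx order show False
          using av2341[of u w z c] av42531[of w u z y c] av45231[of w z u y c] neq[of u w] neq[of u z] by auto
      next
        fix w t assume "z < w" "w < t" "t < y" "p ! y < p ! w" "p ! w < p ! t" "p ! t < p ! z"
        with u zyx order show False
          using av2341[of u w t c] av42531[of w u t y c] av45231[of w t u y c] neq[of u w] neq[of u t] by auto
      qed
    next
      fix u v assume uv: "y < u" "u < v" "v < x" "p ! x < p ! u" "p ! u < p ! v" "p ! v < p ! y"
      from ascent_betweenD[OF distinct yz len(2) zyx(1)] show False
      proof (elim disjE exE conjE)
        fix w assume w: "y < w" "w < length p" "p ! y < p ! w" "p ! w < p ! z"
        with uv zyx order show False
          using av52314[of z u v c w] av2341[of u v w c] av45231[of y w u v c]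
            av42531[of y u w v c] neq[of c w] neq[of u w] neq[of v w]
          by auto
      next
        fix w assume "w < z" "p ! y < p ! w" "p ! w < p ! z"
        with uv zyx order show False
          using av45231[of w z u v c] by auto
      next
        fix w t assume "z < w" "w < t" "t < y" "p ! y < p ! w" "p ! w < p ! t" "p ! t < p ! z"
        with uv zyx order show False
          using av45231[of w t u v c] by auto
      qed
    qed
  qed
qed

lemma pattern_obstruction:
  assumes "t \<in> {[2,3,4,1], [2,5,3,1,4], [4,2,5,1,3], [4,2,5,3,1], [4,5,2,1,3],
    [4,5,2,3,1], [5,2,3,1,4], [6,4,2,1,3,5], [6,4,2,1,5,3]}"
  shows "obstruction t"
proof -
  \<comment> \<open>The instantiations below follow the order of occurrence \<open>i\<close>,
    \<open>c\<close>, \<open>j\<close>, \<open>k\<close>, \<open>p\<close>, then the ascents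
    \<open>u\<close>, \<open>v\<close> and \<open>w\<close>, \<open>x\<close>, all positions counted
    from 0. In every pattern \<open>c\<close>, \<open>i\<close> and \<open>k\<close> are the
    positions of 1, of 2 and of the maximum.\<close>
  have I: "obstruction p"
    if "i < c \<and> j < c \<and> k < c \<and> c < length p \<and> p ! c < p ! i"
      "u < v \<and> v < length p \<and> p ! i \<le> p ! u \<and> p ! u < p ! v \<and> p ! v \<le> p ! j"
      "w < x \<and> x < length p \<and> p ! j \<le> p ! w \<and> p ! w < p ! x \<and> p ! x \<le> p ! k"
    for p c i j k u v w x
    using that unfolding obstruction_def ascent_between_def by blast
  have "obstruction [2,3,4,1]"
    by (rule I[of 0 3 1 2 "[2,3,4,1]" 0 1 1 2]) simp_all
  moreover
  have "obstruction [2,5,3,1,4]"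
    by (rule I[of 0 3 2 1 "[2,5,3,1,4]" 0 2 2 4]) simp_all
  moreover
  have "obstruction [4,2,5,1,3]"
    by (rule I[of 1 3 0 2 "[4,2,5,1,3]" 1 4 0 2]) simp_all
  moreover
  have "obstruction [4,2,5,3,1]"
    by (rule I[of 1 4 0 2 "[4,2,5,3,1]" 1 3 0 2]) simp_all
  moreover
  have "obstruction [4,5,2,1,3]"
    by (rule I[of 2 3 0 1 "[4,5,2,1,3]" 2 4 0 1]) simp_all
  moreover
  have "obstruction [4,5,2,3,1]"
    by (rule I[of 2 4 0 1 "[4,5,2,3,1]" 2 3 0 1]) simp_all
  moreover
  have "obstruction [5,2,3,1,4]"
    by (rule I[of 1 3 2 0 "[5,2,3,1,4]" 1 2 2 4]) simp_all
  moreover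
  have "obstruction [6,4,2,1,3,5]"
    by (rule I[of 2 3 1 0 "[6,4,2,1,3,5]" 2 4 1 5]) simp_all
  moreover
  have "obstruction [6,4,2,1,5,3]"
    by (rule I[of 2 3 1 0 "[6,4,2,1,5,3]" 2 5 1 4]) simp_all
  ultimately show ?thesis
    using assms by (elim insertE emptyE) (simp_all only:)
qed

lemma contains_pattern_4:
  assumes "a < b \<and> b < c \<and> c < d \<and> d < length p"
    and "order_isomorphic [p ! a, p ! b, p ! c, p ! d] t"
  shows "contains_pattern p t"
  by (rule contains_patternI[of "[a, b, c, d]"]) (use assms in auto)

lemma contains_pattern_5:
  assumes "a < b \<and> b < c \<and> c < d \<and> d < e \<and> e < length p"
    and "order_isomorphic [p ! a, p ! b, p ! c, p ! d, p ! e] t"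
  shows "contains_pattern p t"
  by (rule contains_patternI[of "[a, b, c, d, e]"]) (use assms in auto)

lemma contains_pattern_6:
  assumes "a < b \<and> b < c \<and> c < d \<and> d < e \<and> e < f \<and> f < length p"
    and "order_isomorphic [p ! a, p ! b, p ! c, p ! d, p ! e, p ! f] t"
  shows "contains_pattern p t"
  by (rule contains_patternI[of "[a, b, c, d, e, f]"]) (use assms in auto)

lemma contains_pattern_if_obstruction:
  assumes "distinct p" and "obstruction p"
  shows "\<exists>t \<in> {[2,3,4,1], [2,5,3,1,4], [4,2,5,1,3], [4,2,5,3,1], [4,5,2,1,3],
    [4,5,2,3,1], [5,2,3,1,4], [6,4,2,1,3,5], [6,4,2,1,5,3]}. contains_pattern p t"
proof (rule ccontr)
  assume "\<not> ?thesis"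
  then have av: "\<not> contains_pattern p [2,3,4,1]" "\<not> contains_pattern p [2,5,3,1,4]"
    "\<not> contains_pattern p [4,2,5,1,3]" "\<not> contains_pattern p [4,2,5,3,1]"
    "\<not> contains_pattern p [4,5,2,1,3]" "\<not> contains_pattern p [4,5,2,3,1]"
    "\<not> contains_pattern p [5,2,3,1,4]" "\<not> contains_pattern p [6,4,2,1,3,5]"
    "\<not> contains_pattern p [6,4,2,1,5,3]"
    by auto
  show False
  proof (rule no_obstruction_if_avoids[OF assms])
    \<comment> \<open>Here and below, \<open>All_less_Suc\<close>, with numerals in
      \<open>Suc\<close> form, expands order isomorphism to a concrete pattern into finitely many
      comparisons.\<close>
    show "\<not> (a < b \<and> b < c \<and> c < d \<and> d < length p \<and>
      p ! d < p ! a \<and> p ! a < p ! b \<and> p ! b < p ! c)" for a b c d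
      using av(1) contains_pattern_4[of a b c d p "[2,3,4,1]"]
      by (auto simp: order_isomorphic_def All_less_Suc numeral_eq_Suc)
    show "\<not> (a < b \<and> b < c \<and> c < d \<and> d < e \<and> e < length p \<and>
      p ! d < p ! a \<and> p ! a < p ! c \<and> p ! c < p ! e \<and> p ! e < p ! b)" for a b c d e
      using av(2) contains_pattern_5[of a b c d e p "[2,5,3,1,4]"]
      by (auto simp: order_isomorphic_def All_less_Suc numeral_eq_Suc)
    show "\<not> (a < b \<and> b < c \<and> c < d \<and> d < e \<and> e < length p \<and>
      p ! d < p ! b \<and> p ! b < p ! e \<and> p ! e < p ! a \<and> p ! a < p ! c)" for a b c d e
      using av(3) contains_pattern_5[of a b c d e p "[4,2,5,1,3]"]
      by (auto simp: order_isomorphic_def All_less_Suc numeral_eq_Suc)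
    show "\<not> (a < b \<and> b < c \<and> c < d \<and> d < e \<and> e < length p \<and>
      p ! e < p ! b \<and> p ! b < p ! d \<and> p ! d < p ! a \<and> p ! a < p ! c)" for a b c d e
      using av(4) contains_pattern_5[of a b c d e p "[4,2,5,3,1]"]
      by (auto simp: order_isomorphic_def All_less_Suc numeral_eq_Suc)
    show "\<not> (a < b \<and> b < c \<and> c < d \<and> d < e \<and> e < length p \<and>
      p ! d < p ! c \<and> p ! c < p ! e \<and> p ! e < p ! a \<and> p ! a < p ! b)" for a b c d e
      using av(5) contains_pattern_5[of a b c d e p "[4,5,2,1,3]"]
      by (auto simp: order_isomorphic_def All_less_Suc numeral_eq_Suc)
    show "\<not> (a < b \<and> b < c \<and> c < d \<and> d < e \<and> e < length p \<and>
      p ! e < p ! c \<and> p ! c < p ! d \<and> p ! d < p ! a \<and> p ! a < p ! b)" for a b c d e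
      using av(6) contains_pattern_5[of a b c d e p "[4,5,2,3,1]"]
      by (auto simp: order_isomorphic_def All_less_Suc numeral_eq_Suc)
    show "\<not> (a < b \<and> b < c \<and> c < d \<and> d < e \<and> e < length p \<and>
      p ! d < p ! b \<and> p ! b < p ! c \<and> p ! c < p ! e \<and> p ! e < p ! a)" for a b c d e
      using av(7) contains_pattern_5[of a b c d e p "[5,2,3,1,4]"]
      by (auto simp: order_isomorphic_def All_less_Suc numeral_eq_Suc)
    show "\<not> (a < b \<and> b < c \<and> c < d \<and> d < e \<and> e < f \<and> f < length p \<and>
      p ! d < p ! c \<and> p ! c < p ! e \<and> p ! e < p ! b \<and> p ! b < p ! f \<and> p ! f < p ! a)" for a b c d e f
      using av(8) contains_pattern_6[of a b c d e f p "[6,4,2,1,3,5]"]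
      by (auto simp: order_isomorphic_def All_less_Suc numeral_eq_Suc)
    show "\<not> (a < b \<and> b < c \<and> c < d \<and> d < e \<and> e < f \<and> f < length p \<and>
      p ! d < p ! c \<and> p ! c < p ! f \<and> p ! f < p ! b \<and> p ! b < p ! e \<and> p ! e < p ! a)" for a b c d e f
      using av(9) contains_pattern_6[of a b c d e f p "[6,4,2,1,5,3]"]
      by (auto simp: order_isomorphic_def All_less_Suc numeral_eq_Suc)
  qed
qed

section \<open>Necessity: runs of the machine on an obstructed permutation\<close>

text \<open>A step removes at most one input entry, so a run that empties the input passes through
  every suffix of it. This permits stopping a run just before a chosen entry is read.\<close>

lemma steps_consume:
  assumes "step\<^sup>*\<^sup>* s s'" and "suffix ys (fst s)" and "fst s' = []"
  shows "\<exists>m. step\<^sup>*\<^sup>* s m \<and> step\<^sup>*\<^sup>* m s' \<and> fst m = ys"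
  using assms
proof (induction rule: converse_rtranclp_induct)
  case base
  then show ?case by (intro exI[of _ s']) auto
next
  case (step s m)
  show ?case
  proof (cases "fst s = ys")
    case True
    then show ?thesis
      using converse_rtranclp_into_rtranclp[of step, OF step.hyps] by blast
  next
    case False
    have "suffix ys (fst m)"
      using step.hyps(1) False step.prems(1) by cases (auto simp: suffix_Cons)
    then show ?thesis
      using step.hyps(1) step.IH step.prems(2) by (meson converse_rtranclp_into_rtranclp)
  qed
qed

text \<open>An invariant of runs on \<open>p\<close>, with \<open>pre\<close> the part read so far.
  Stacks are listed from the top, so reversing one gives the order in which its entries
  arrived.\<close>

definition consistent :: "nat list \<Rightarrow> state \<Rightarrow> bool" where
  "consistent p = (\<lambda>(inp, s1, s2, out). \<exists>pre. p = pre @ inp \<and> subseq (rev s1) pre \<and>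
     subseq (rev s2) pre \<and> set pre = set s1 \<union> set s2 \<union> set out)"

lemma consistent_step:
  assumes "consistent p s" and "step s s'"
  shows "consistent p s'"
  using assms(2,1)
proof cases
  case (push1 x inp s1 s2 out)
  with assms(1) obtain pre where "p = pre @ x # inp" "subseq (rev s1) pre" "subseq (rev s2) pre"
    "set pre = set s1 \<union> set s2 \<union> set out"
    by (auto simp: consistent_def)
  with push1 show ?thesis
    by (auto simp: consistent_def intro!: exI[of _ "pre @ [x]"])
next
  case (push2 x inp s1 s2 out)
  with assms(1) obtain pre where "p = pre @ x # inp" "subseq (rev s1) pre" "subseq (rev s2) pre"
    "set pre = set s1 \<union> set s2 \<union> set out"
    by (auto simp: consistent_def)
  with push2 show ?thesis
    by (auto simp: consistent_def intro!: exI[of _ "pre @ [x]"])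
next
  case (bypass x inp s1 s2 out)
  with assms(1) obtain pre where "p = pre @ x # inp" "subseq (rev s1) pre" "subseq (rev s2) pre"
    "set pre = set s1 \<union> set s2 \<union> set out"
    by (auto simp: consistent_def)
  with bypass show ?thesis
    by (auto simp: consistent_def intro!: exI[of _ "pre @ [x]"])
qed (auto simp: consistent_def)

lemma consistent_steps: "step\<^sup>*\<^sup>* s s' \<Longrightarrow> consistent p s \<Longrightarrow> consistent p s'"
  by (induction rule: rtranclp_induct) (auto intro: consistent_step)

text \<open>Output is only ever appended, and a pop emits a whole stack contiguously. If more
  entries are pushed before the pop, the present content remains a contiguous part of what is
  popped.\<close>

lemma steps_output:
  assumes "step\<^sup>*\<^sup>* s ([], [], [], out)"
  shows "prefix (snd (snd (snd s))) out \<and> sublist (fst (snd s)) out \<and> sublist (fst (snd (snd s))) out"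
  using assms
proof (induction rule: converse_rtranclp_induct)
  case base
  then show ?case by simp
next
  case (step s m)
  from step.hyps(1) step.IH show ?case
    by cases (auto simp: prefix_def sublist_def, (metis append_Cons append_assoc append_Nil)+)
qed

text \<open>By distinctness the embedding of \<open>zs\<close> must use the positions
  \<open>i\<close> and \<open>j\<close> themselves, so the two values occur in \<open>zs\<close> in
  the same order as in \<open>p\<close>.\<close>

lemma descending_subseq_nth:
  fixes p :: "nat list"
  assumes "subseq zs p" and "distinct p" and "sorted_wrt (>) zs"
    and "i < j" and "j < length p" and "p ! i \<in> set zs" and "p ! j \<in> set zs"
  shows "p ! j < p ! i"
proof -
  obtain g where g: "strict_mono_on {..<length zs} g"
    and gl: "\<And>i. i < length zs \<Longrightarrow> g i < length p" and gx: "\<And>i. i < length zs \<Longrightarrow> p ! g i = zs ! i"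
    using subseq_indices[OF assms(1)] by metis
  obtain a b where ab: "a < length zs" "zs ! a = p ! i" "b < length zs" "zs ! b = p ! j"
    using assms(6,7) by (metis in_set_conv_nth)
  have "g a = i" "g b = j"
    using ab gl gx assms(2,4,5) by (metis nth_eq_iff_index_eq order.strict_trans)+
  then have "a < b"
    using assms(4) g ab by (metis lessThan_iff not_less_iff_gr_or_eq order.asym strict_mono_onD)
  then show ?thesis
    using assms(3) ab by (metis sorted_wrt_nth_less)
qed

lemma sublist_upt:
  assumes "sublist s [m..<n]"
  obtains a b where "s = [a..<b]"
proof -
  obtain ps ss where "[m..<n] = ps @ s @ ss"
    using assms by (auto simp: sublist_def)
  then have "s = take (length s) (drop (length ps) [m..<n])"
    by simp
  also have "\<dots> = [m + length ps..<min n (m + length ps + length s)]"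
    by (simp add: min_def take_upt)
  finally show ?thesis by (rule that)
qed

text \<open>A stack that will be output correctly holds an interval of values that arrived in
  decreasing order. An ascent with values between \<open>y\<close> and \<open>z\<close> would lie in
  that interval and arrive in increasing order.\<close>

lemma no_ascent_in_stack:
  assumes "distinct p" and "subseq (rev s) p" and "sublist s [m..<n]"
    and "y \<in> set s" and "z \<in> set s"
  shows "\<not> ascent_between p y z"
proof
  assume "ascent_between p y z"
  then obtain u v where uv: "u < v" "v < length p" "y \<le> p ! u" "p ! u < p ! v" "p ! v \<le> z"
    unfolding ascent_between_def by blast
  obtain a b where s: "s = [a..<b]"
    using sublist_upt[OF assms(3)] .
  have "p ! v < p ! u"
    by (rule descending_subseq_nth[OF assms(2,1)])
      (use uv s assms(4,5) in \<open>auto simp: sorted_wrt_rev\<close>)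
  then show False using uv by simp
qed

lemma ascent_between_mono:
  "ascent_between p x y \<Longrightarrow> y \<le> z \<Longrightarrow> ascent_between p x z"
  unfolding ascent_between_def by (meson order.trans)

text \<open>Just before \<open>p ! c\<close> is read, the three larger entries of the obstruction
  have been read but cannot have been output, so two of them share a stack, contrary to the ascents
  between them.\<close>

lemma sortable_imp_no_obstruction:
  assumes "is_perm p" and "sortable p"
  shows "\<not> obstruction p"
proof
  assume "obstruction p"
  then obtain c i j k where less: "i < c" "j < c" "k < c" "c < length p" "p ! c < p ! i"
    and asc: "ascent_between p (p ! i) (p ! j)" "ascent_between p (p ! j) (p ! k)"
    unfolding obstruction_def by blast
  have dist: "distinct p"
    using assms(1) by (simp add: is_perm_def)
  from assms(2) have "step\<^sup>*\<^sup>* (p, [], [], []) ([], [], [], [1..<Suc (length p)])"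
    by (simp add: sortable_def)
  from steps_consume[OF this, of "drop c p"] obtain s1 s2 out where
    run1: "step\<^sup>*\<^sup>* (p, [], [], []) (drop c p, s1, s2, out)" and
    run2: "step\<^sup>*\<^sup>* (drop c p, s1, s2, out) ([], [], [], [1..<Suc (length p)])"
    by (auto simp: suffix_drop)
  have "consistent p (drop c p, s1, s2, out)"
    by (rule consistent_steps[OF run1]) (simp add: consistent_def)
  then obtain pre where pre: "p = pre @ drop c p" "subseq (rev s1) pre" "subseq (rev s2) pre"
    "set pre = set s1 \<union> set s2 \<union> set out"
    by (auto simp: consistent_def)
  have "pre = take c p"
    using pre(1) by (metis append_same_eq append_take_drop_id)
  have out: "prefix out [1..<Suc (length p)]" and sub: "sublist s1 [1..<Suc (length p)]"
    "sublist s2 [1..<Suc (length p)]"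
    using steps_output[OF run2] by auto
  have rev_s: "subseq (rev s1) p" "subseq (rev s2) p"
    using pre by (metis prefixI prefix_imp_subseq subseq_order.order_trans)+
  \<comment> \<open>Output entries belong to the part read so far, and \<open>p ! c\<close> does
    not.\<close>
  have "p ! c \<notin> set out"
  proof
    assume "p ! c \<in> set out"
    then have "p ! c \<in> set (take c p)"
      using pre(4) \<open>pre = take c p\<close> by blast
    then show False
      using dist less(4) by (auto simp: in_set_conv_nth nth_eq_iff_index_eq)
  qed
  \<comment> \<open>The output is an initial segment of 1, 2, and so on, so it could contain
    \<open>y\<close> only together with \<open>p ! c\<close>.\<close>
  have not_out: "y \<notin> set out" if "p ! c \<le> y" for y
  proof
    assume "y \<in> set out"
    have "1 \<le> p ! c"
      using assms(1) nth_mem[OF less(4)] by (auto simp: is_perm_def)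
    moreover obtain m where "out = take m [1..<Suc (length p)]"
      using out by (metis take_is_prefix prefix_def append_eq_conv_conj)
    ultimately have "p ! c \<in> set out"
      using that \<open>y \<in> set out\<close>
      by (cases "1 + m \<le> Suc (length p)") (auto simp: take_upt simp del: upt_Suc)
    with \<open>p ! c \<notin> set out\<close> show False ..
  qed
  have stack: "p ! l \<in> set s1 \<or> p ! l \<in> set s2" if "l < c" "p ! c \<le> p ! l" for l
  proof -
    have "p ! l \<in> set (take c p)"
      using that less(4) by (auto simp: in_set_conv_nth intro!: exI[of _ l])
    then show ?thesis
      using pre(4) \<open>pre = take c p\<close> not_out[OF that(2)] by blast
  qed
  have mem: "p ! l \<in> set s1 \<or> p ! l \<in> set s2" if "l \<in> {i, j, k}" for l
    using that stack[of i] stack[of j] stack[of k] less ascent_between_less[OF asc(1)] ascent_between_less[OF asc(2)] by auto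
  \<comment> \<open>The two entries sharing a stack may be the outer ones, so this pair needs an
    ascent as well.\<close>
  have "ascent_between p (p ! i) (p ! k)"
    using ascent_between_mono[OF asc(1)] ascent_between_less[OF asc(2)] by simp
  moreover have "\<not> ascent_between p y z" if "y \<in> set s1 \<and> z \<in> set s1 \<or> y \<in> set s2 \<and> z \<in> set s2" for y z
    using that no_ascent_in_stack[OF dist rev_s(1) sub(1)] no_ascent_in_stack[OF dist rev_s(2) sub(2)]
    by blast
  ultimately show False
    using asc mem[of i] mem[of j] mem[of k] by auto
qed

section \<open>Sufficiency: the greedy strategy\<close>

text \<open>A block \<open>[a..<b]\<close> with this property cannot be extended upwards: \<open>b\<close> does not precede \<open>b - 1\<close>.\<close>

definition block_end :: "nat list \<Rightarrow> nat \<Rightarrow> bool" where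
  "block_end p b \<longleftrightarrow>
     (\<forall>i < length p. \<forall>j < length p. Suc (p ! i) = b \<and> p ! j = b \<longrightarrow> i < j)"

text \<open>Only the upper end has to be final: the list starts at the top of the stack, so pushing
  \<open>a - 1\<close> still extends the interval downwards. An empty stack arises from any
  \<open>a\<close> and \<open>b\<close> with \<open>b \<le> a\<close> and carries no condition on
  \<open>b\<close>.\<close>

definition block :: "nat list \<Rightarrow> nat \<Rightarrow> nat list \<Rightarrow> bool" where
  "block p m s \<longleftrightarrow> (\<exists>a b. s = [a..<b] \<and> m \<le> a \<and> (a < b \<longrightarrow> block_end p b))"

text \<open>
  \<open>R\<close> is the set of entries read so far and \<open>{1..<m}\<close> has been output.  \<open>m\<close> itself may still be
  on top of a stack; the greedy strategy then pops that stack.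
\<close>

definition loaded :: "nat list \<Rightarrow> nat set \<Rightarrow> nat \<Rightarrow> nat list \<Rightarrow> nat list \<Rightarrow> bool" where
  "loaded p R m s1 s2 \<longleftrightarrow> 1 \<le> m \<and> R = {1..<m} \<union> set s1 \<union> set s2 \<and>
     set s1 \<inter> set s2 = {} \<and> block p m s1 \<and> block p m s2"

lemma block_Nil [simp]: "block p m []"
  unfolding block_def by (intro exI[of _ m]) simp

lemma block_nonemptyE:
  assumes "block p m s" and "s \<noteq> []"
  obtains a b where "s = [a..<b]" and "m \<le> a" and "a < b" and "block_end p b"
  using assms unfolding block_def by auto

lemma loaded_swap: "loaded p R m s1 s2 \<Longrightarrow> loaded p R m s2 s1"
  unfolding loaded_def by auto

text \<open>A block starts at \<open>m\<close> or above, so one containing \<open>m\<close> starts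
  exactly there. The other block avoids \<open>[m..<b]\<close> and hence starts at \<open>b\<close>
  or later, which lets the bound rise from \<open>m\<close> to \<open>b\<close>.\<close>

lemma loaded_pop:
  assumes "loaded p R m s1 s2" and "m \<in> set s1"
  obtains b where "s1 = [m..<b]" and "m < b" and "loaded p R b [] s2"
proof -
  have "s1 \<noteq> []" "block p m s1"
    using assms by (auto simp: loaded_def)
  then obtain b where s1: "s1 = [m..<b]" and b: "m < b"
    using block_nonemptyE assms(2) by (metis atLeastLessThan_iff le_antisym set_upt)
  have "block p b s2"
  proof (cases "s2 = []")
    case False
    moreover have "block p m s2"
      using assms(1) by (simp add: loaded_def)
    ultimately obtain a b' where s2: "s2 = [a..<b']" "m \<le> a" "a < b'" "block_end p b'"
      using block_nonemptyE by metis
    have "a \<notin> set s1"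
      using assms(1) s2 by (auto simp: loaded_def)
    then have "b \<le> a"
      using s1 s2(2) by auto
    then show ?thesis
      unfolding block_def using s2 by blast
  qed simp
  moreover have "{1..<m} \<union> set [m..<b] = {1..<b}"
    using assms(1) b by (auto simp: loaded_def)
  ultimately have "loaded p R b [] s2"
    using assms(1) b s1 unfolding loaded_def by auto
  then show ?thesis
    using that s1 b by blast
qed

text \<open>As long as the next value to be output has been read, it is in a stack and that stack
  can be popped. Each such pop empties a nonempty stack, so the total stack length
  decreases.\<close>

lemma loaded_flush:
  assumes "loaded p R m s1 s2"
  shows "\<exists>m' s1' s2'. step\<^sup>*\<^sup>* (inp, s1, s2, [1..<m]) (inp, s1', s2', [1..<m']) \<and>
    loaded p R m' s1' s2' \<and> m' \<notin> R"
  using assms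
proof (induction "length s1 + length s2" arbitrary: m s1 s2 rule: less_induct)
  case less
  have m: "1 \<le> m"
    using less.prems by (simp add: loaded_def)
  consider "m \<notin> R" | "m \<in> set s1" | "m \<in> set s2"
    using less.prems by (auto simp: loaded_def)
  then show ?case
  proof cases
    case 1
    then show ?thesis using less.prems by blast
  next
    case 2
    obtain b where b: "s1 = [m..<b]" "m < b" "loaded p R b [] s2"
      using loaded_pop[OF less.prems 2] .
    have "[1..<m] @ s1 = [1..<b]"
      using b m by (metis le_add_diff_inverse less_imp_le upt_add_eq_append)
    then have pop: "step (inp, s1, s2, [1..<m]) (inp, [], s2, [1..<b])"
      using step.pop1[of inp s1 s2 "[1..<m]"] by simp
    have "length [] + length s2 < length s1 + length s2"
      using b by simp
    from less.hyps[OF this b(3)] show ?thesis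
      using converse_rtranclp_into_rtranclp[of step, OF pop] by blast
  next
    case 3
    obtain b where b: "s2 = [m..<b]" "m < b" and "loaded p R b [] s1"
      using loaded_pop[OF loaded_swap[OF less.prems] 3] .
    note loaded_b = loaded_swap[OF this(3)]
    have "[1..<m] @ s2 = [1..<b]"
      using b m by (metis le_add_diff_inverse less_imp_le upt_add_eq_append)
    then have pop: "step (inp, s1, s2, [1..<m]) (inp, s1, [], [1..<b])"
      using step.pop2[of inp s1 s2 "[1..<m]"] by simp
    have "length s1 + length [] < length s1 + length s2"
      using b by simp
    from less.hyps[OF this loaded_b] show ?thesis
      using converse_rtranclp_into_rtranclp[of step, OF pop] by blast
  qed
qed

text \<open>The alternatives in the last hypothesis are the two pushes of the greedy strategy:
  continuing an interval downwards, or opening a new one whose upper end is final.\<close>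

lemma loaded_push:
  assumes "loaded p R m s1 s2" and "x \<notin> R" and "m \<le> x"
    and "s1 \<noteq> [] \<and> Suc x = hd s1 \<or> s1 = [] \<and> block_end p (Suc x)"
  shows "loaded p (insert x R) m (x # s1) s2"
proof -
  have "block p m (x # s1)"
    using assms(4)
  proof
    assume s1: "s1 \<noteq> [] \<and> Suc x = hd s1"
    have "block p m s1"
      using assms(1) by (simp add: loaded_def)
    with s1 obtain b where "s1 = [Suc x..<b]" "Suc x < b" "block_end p b"
      using block_nonemptyE hd_upt by metis
    then show ?thesis
      unfolding block_def using assms(3)
      by (intro exI[of _ x] exI[of _ b]) (simp add: upt_conv_Cons)
  next
    assume "s1 = [] \<and> block_end p (Suc x)"
    then show ?thesis
      unfolding block_def using assms(3) by (intro exI[of _ x] exI[of _ "Suc x"]) simp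
  qed
  then show ?thesis
    using assms(1,2) unfolding loaded_def by auto
qed

text \<open>For the block \<open>[a..<b]\<close>, a larger value outside it is at least
  \<open>b\<close>. Maximality of the block places \<open>b - 1\<close> before \<open>b\<close> in
  \<open>p\<close>, and this is the ascent.\<close>

lemma ascent_between_blocks:
  assumes "is_perm p" and "block p m s" and "s \<noteq> []" and "z \<in> set p" and "z \<notin> set s"
    and "hd s < z" and "1 \<le> m"
  shows "ascent_between p (hd s) z"
proof -
  obtain a b where b: "s = [a..<b]" "m \<le> a" "a < b" "block_end p b"
    using block_nonemptyE[OF assms(2,3)] .
  then have "b \<le> z"
    using assms(5,6) by simp
  moreover have "z \<le> length p"
    using assms(1,4) by (auto simp: is_perm_def)
  ultimately have "b \<in> set p" "b - 1 \<in> set p"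
    using assms(1,7) b by (auto simp: is_perm_def)
  then obtain u v where uv: "u < length p" "p ! u = b - 1" "v < length p" "p ! v = b"
    by (metis in_set_conv_nth)
  then have "u < v"
    using b unfolding block_end_def by simp
  then show ?thesis
    unfolding ascent_between_def using uv b \<open>b \<le> z\<close> by (intro exI[of _ u] exI[of _ v]) simp
qed

text \<open>The arriving entry must wait for the unread \<open>m\<close> and, its successor being
  unread, can join neither block. Together with the tops of the two stacks it gives three waiting
  values from different intervals; the position of \<open>m\<close> serves as
  \<open>c\<close>.\<close>

lemma obstruction_if_both_blocked:
  assumes "is_perm p" and "t < length p" and "loaded p (set (take t p)) m s1 s2"
    and "m \<notin> set (take t p)" and "m < p ! t" and "Suc (p ! t) \<notin> set (take t p)"
    and "s1 \<noteq> []" and "s2 \<noteq> []"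
  shows "obstruction p"
proof -
  have dist: "distinct p" and set_p: "set p = {1..length p}"
    using assms(1) by (auto simp: is_perm_def)
  have taken: "\<exists>i \<le> t. p ! i = y" if "y \<in> insert (p ! t) (set (take t p))" for y
    using that by (auto simp: in_set_conv_nth intro: less_imp_le)
  have later: "i > t" if "p ! i \<notin> insert (p ! t) (set (take t p))" "i < length p" for i
  proof (rule ccontr)
    assume "\<not> t < i"
    then have "i = t \<or> i < t" by auto
    then show False
      using that assms(2) by (auto simp: in_set_conv_nth)
  qed
  have m: "1 \<le> m" and R: "set (take t p) = {1..<m} \<union> set s1 \<union> set s2"
    and disj: "set s1 \<inter> set s2 = {}" and blocks: "block p m s1" "block p m s2"
    using assms(3) by (auto simp: loaded_def)
  have x: "p ! t \<in> set p" "p ! t \<notin> set (take t p)"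
    using assms(2) dist by (auto simp: in_set_conv_nth nth_eq_iff_index_eq)
  have "m \<in> set p"
    using set_p m assms(5) x(1) by auto
  then obtain c where c: "c < length p" "p ! c = m"
    by (auto simp: in_set_conv_nth)
  have "t < c"
    using later[of c] c assms(4,5) by auto
  have hds: "hd s1 \<in> set s1" "hd s2 \<in> set s2"
    using assms(7,8) by auto
  have in_p: "hd s1 \<in> set p" "hd s2 \<in> set p"
    using hds R set_take_subset[of t p] by blast+
  \<comment> \<open>The successor of \<open>p ! t\<close> is at most \<open>z\<close>, hence an
    entry, and it comes later; the two form the ascent.\<close>
  have asc_x: "ascent_between p (p ! t) z" if "p ! t < z" "z \<in> set p" for z
  proof -
    have "Suc (p ! t) \<in> set p"
      using that set_p by auto
    then obtain v where v: "v < length p" "p ! v = Suc (p ! t)"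
      by (auto simp: in_set_conv_nth)
    then have "t < v"
      using later[of v] assms(6) by auto
    then show ?thesis
      unfolding ascent_between_def using v that by (intro exI[of _ t] exI[of _ v]) simp
  qed
  have notin: "p ! t \<notin> set s1" "p ! t \<notin> set s2" "hd s1 \<notin> set s2" "hd s2 \<notin> set s1"
    using x(2) R disj hds by auto
  have asc: "ascent_between p y z"
    if "y < z" "y \<in> {p ! t, hd s1, hd s2}" "z \<in> {p ! t, hd s1, hd s2}" for y z
    using that in_p x(1) notin
    by (auto intro: asc_x ascent_between_blocks[OF assms(1) blocks(1) assms(7) _ _ _ m]
        ascent_between_blocks[OF assms(1) blocks(2) assms(8) _ _ _ m])
  have "m \<le> hd s1" "m \<le> hd s2"
    using block_nonemptyE[OF blocks(1) assms(7)] block_nonemptyE[OF blocks(2) assms(8)]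
    by (metis hd_upt)+
  moreover have "m \<noteq> hd s1" "m \<noteq> hd s2"
    using assms(4) R hds by auto
  ultimately have gt: "m < y" if "y \<in> {p ! t, hd s1, hd s2}" for y
    using that assms(5) by auto
  \<comment> \<open>The relative size of the three values is unknown, so the obstruction is built
    for an arbitrary increasing arrangement of them.\<close>
  have obs: "obstruction p" if "y1 < y2" "y2 < y3" "{y1, y2, y3} = {p ! t, hd s1, hd s2}" for y1 y2 y3
  proof -
    have y: "y1 \<in> {p ! t, hd s1, hd s2}" "y2 \<in> {p ! t, hd s1, hd s2}" "y3 \<in> {p ! t, hd s1, hd s2}"
      using that(3) by blast+
    have "{p ! t, hd s1, hd s2} \<subseteq> insert (p ! t) (set (take t p))"
      using R hds by auto
    then obtain i j k where "i \<le> t" "p ! i = y1" "j \<le> t" "p ! j = y2" "k \<le> t" "p ! k = y3"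
      using taken y by (meson subsetD)
    then show ?thesis
      unfolding obstruction_def
      using asc[OF that(1) y(1,2)] asc[OF that(2) y(2,3)] gt[OF y(1)] c \<open>t < c\<close>
      by (intro exI[of _ c] exI[of _ i] exI[of _ j] exI[of _ k]) simp
  qed
  have "p ! t \<noteq> hd s1" "p ! t \<noteq> hd s2" "hd s1 \<noteq> hd s2"
    using notin hds by auto
  then consider "p ! t < hd s1" "hd s1 < hd s2" | "p ! t < hd s2" "hd s2 < hd s1"
    | "hd s1 < p ! t" "p ! t < hd s2" | "hd s1 < hd s2" "hd s2 < p ! t"
    | "hd s2 < p ! t" "p ! t < hd s1" | "hd s2 < hd s1" "hd s1 < p ! t"
    by linarith
  then show ?thesis
    by cases (rule obs, assumption, assumption, blast)+
qed

text \<open>The greedy strategy for the next entry \<open>x\<close>: bypass it if it is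
  \<open>m\<close>, else push it onto \<open>Suc x\<close> if that is the top of a stack, else onto
  an empty stack. Having neither choice would be an obstruction.\<close>

lemma loaded_run:
  assumes "is_perm p" and "\<not> obstruction p" and "t \<le> length p"
  shows "\<exists>m s1 s2. step\<^sup>*\<^sup>* (p, [], [], []) (drop t p, s1, s2, [1..<m]) \<and>
    loaded p (set (take t p)) m s1 s2 \<and> m \<notin> set (take t p)"
  using assms(3)
proof (induction t)
  case 0
  show ?case
    by (intro exI[of _ 1] exI[of _ "[]"]) (simp add: loaded_def)
next
  case (Suc t)
  define x R where "x = p ! t" and "R = set (take t p)"
  obtain m s1 s2 where run: "step\<^sup>*\<^sup>* (p, [], [], []) (drop t p, s1, s2, [1..<m])"
    and loaded: "loaded p R m s1 s2" and m: "m \<notin> R"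
    using Suc unfolding R_def by auto
  have t: "t < length p" and drop_t: "drop t p = x # drop (Suc t) p"
    using Suc.prems by (auto simp: x_def Cons_nth_drop_Suc)
  have R_Suc: "set (take (Suc t) p) = insert x R"
    using t by (simp add: take_Suc_conv_app_nth x_def R_def)
  have x: "x \<notin> R"
    using t assms(1) by (auto simp: x_def R_def is_perm_def in_set_conv_nth nth_eq_iff_index_eq)
  have "1 \<le> x"
    using t assms(1) nth_mem[OF t] by (auto simp: x_def is_perm_def)
  then have "m \<le> x"
    using x loaded by (auto simp: loaded_def)
  \<comment> \<open>It suffices to give one machine step that keeps the state loaded; flushing
    afterwards restores that the next value to be output is unread.\<close>
  have extend: ?case if next_step: "step (x # drop (Suc t) p, s1, s2, [1..<m]) (drop (Suc t) p, s1', s2', [1..<m'])"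
    and next_loaded: "loaded p (insert x R) m' s1' s2'" for s1' s2' m'
  proof -
    obtain m'' s1'' s2'' where flush:
      "step\<^sup>*\<^sup>* (drop (Suc t) p, s1', s2', [1..<m']) (drop (Suc t) p, s1'', s2'', [1..<m''])"
      "loaded p (insert x R) m'' s1'' s2''" "m'' \<notin> insert x R"
      using loaded_flush[OF next_loaded] by blast
    have "step\<^sup>*\<^sup>* (p, [], [], []) (drop (Suc t) p, s1'', s2'', [1..<m''])"
      using run next_step flush(1) unfolding drop_t by (meson rtranclp.rtrancl_into_rtrancl rtranclp_trans)
    then show ?thesis
      using flush(2,3) unfolding R_Suc by blast
  qed
  show ?case
  proof (cases "x = m")
    case True
    have s: "m \<notin> set s1" "m \<notin> set s2"
      using m loaded by (auto simp: loaded_def)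
    \<comment> \<open>After the bypass the lower bound of the blocks increases, which is harmless
      because \<open>m\<close> is in neither stack.\<close>
    have up: "block p (Suc m) s" if s: "block p m s" "m \<notin> set s" for s
    proof (cases "s = []")
      case False
      obtain a b where ab: "s = [a..<b]" "m \<le> a" "a < b" "block_end p b"
        using block_nonemptyE[OF s(1) False] .
      then have "Suc m \<le> a"
        using s(2) by auto
      then show ?thesis
        unfolding block_def using ab by blast
    qed simp
    have bypassed: "loaded p (insert x R) (Suc m) s1 s2"
      using loaded s up True unfolding loaded_def by auto
    have "[1..<m] @ [x] = [1..<Suc m]"
      using loaded True by (simp add: loaded_def)
    then have "step (x # drop (Suc t) p, s1, s2, [1..<m]) (drop (Suc t) p, s1, s2, [1..<Suc m])"
      using step.bypass[of x "drop (Suc t) p" s1 s2 "[1..<m]"] by argo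
    then show ?thesis
      by (rule extend[OF _ bypassed])
  next
    case False
    with \<open>m \<le> x\<close> have "m < x" by simp
    show ?thesis
    proof (cases "s1 \<noteq> [] \<and> Suc x = hd s1")
      case True
      then show ?thesis
        by (intro extend[OF step.push1 loaded_push[OF loaded x \<open>m \<le> x\<close>]] disjI1)
    next
      case not1: False
      show ?thesis
      proof (cases "s2 \<noteq> [] \<and> Suc x = hd s2")
        case True
        then show ?thesis
          by (intro disjI1 extend[OF step.push2
                loaded_swap[OF loaded_push[OF loaded_swap[OF loaded] x \<open>m \<le> x\<close>]]])
      next
        case not2: False
        \<comment> \<open>If \<open>Suc x\<close> were in an interval without being its least
          element, then \<open>x\<close> would be in it too.\<close>
        have no_hd: "Suc x \<notin> set s" if s: "block p m s" "x \<notin> set s" "\<not> (s \<noteq> [] \<and> Suc x = hd s)" for s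
        proof
          assume "Suc x \<in> set s"
          then have "s \<noteq> []" by auto
          then obtain a b where "s = [a..<b]" "a < b"
            using block_nonemptyE[OF s(1)] by metis
          then show False
            using \<open>Suc x \<in> set s\<close> s(2,3) by auto
        qed
        have fresh: "Suc x \<notin> R"
          using loaded no_hd[of s1] no_hd[of s2] not1 not2 x \<open>m < x\<close>
          by (auto simp: loaded_def)
        \<comment> \<open>The value \<open>Suc x\<close> is unread when \<open>x\<close> arrives, so
          it can occur only after \<open>x\<close>.\<close>
        have "block_end p (Suc x)"
          unfolding block_end_def
        proof (intro allI impI)
          fix i j assume ij: "i < length p" "j < length p" "Suc (p ! i) = Suc x \<and> p ! j = Suc x"
          then have "i = t"
            using assms(1) t by (auto simp: x_def is_perm_def nth_eq_iff_index_eq)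
          moreover have "\<not> j < t"
            using ij fresh by (auto simp: R_def in_set_conv_nth)
          moreover have "j \<noteq> t"
            using ij by (auto simp: x_def)
          ultimately show "i < j" by simp
        qed
        then have ?thesis if "s1 = []"
          using that by (intro disjI2 conjI extend[OF step.push1 loaded_push[OF loaded x \<open>m \<le> x\<close>]])
        moreover have ?thesis if "s2 = []"
          using that \<open>block_end p (Suc x)\<close> by (intro disjI2 conjI extend[OF step.push2
                loaded_swap[OF loaded_push[OF loaded_swap[OF loaded] x \<open>m \<le> x\<close>]]])
        moreover have "s1 = [] \<or> s2 = []"
          using obstruction_if_both_blocked[OF assms(1) t loaded[unfolded R_def] m[unfolded R_def]]
            assms(2) \<open>m < x\<close> fresh
          by (auto simp: x_def R_def)
        ultimately show ?thesis by blast
      qed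
    qed
  qed
qed

text \<open>When all entries are read, \<open>m\<close> is not an entry and so exceeds
  \<open>length p\<close>. A nonempty block would start at an entry no smaller than
  \<open>m\<close>, so both stacks are empty and the output is complete.\<close>

lemma no_obstruction_imp_sortable:
  assumes "is_perm p" and "\<not> obstruction p"
  shows "sortable p"
proof -
  obtain m s1 s2 where run: "step\<^sup>*\<^sup>* (p, [], [], []) ([], s1, s2, [1..<m])"
    and loaded: "loaded p (set p) m s1 s2" and m: "m \<notin> set p"
    using loaded_run[OF assms, of "length p"] by auto
  have set_p: "set p = {1..length p}"
    using assms(1) by (simp add: is_perm_def)
  have "1 \<le> m" and R: "{1..length p} = {1..<m} \<union> set s1 \<union> set s2"
    and blocks: "block p m s1" "block p m s2"
    using loaded set_p by (auto simp: loaded_def)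
  have "length p < m"
    using m \<open>1 \<le> m\<close> set_p by auto
  have "s = []" if s: "block p m s" "set s \<subseteq> {1..length p}" for s
  proof (rule ccontr)
    assume "s \<noteq> []"
    then obtain a b where "s = [a..<b]" "m \<le> a" "a < b"
      using block_nonemptyE[OF s(1)] by metis
    then have "a \<in> {1..length p}"
      using s(2) by auto
    then show False
      using \<open>length p < m\<close> \<open>m \<le> a\<close> by simp
  qed
  then have "s1 = []" "s2 = []"
    using blocks R by blast+
  moreover have "m = Suc (length p)"
  proof -
    have "m - 1 \<le> length p"
    proof (cases "m = 1")
      case False
      then have "m - 1 \<in> {1..<m}"
        using \<open>1 \<le> m\<close> by auto
      then show ?thesis using R by auto
    qed simp
    then show ?thesis using \<open>length p < m\<close> by simp
  qed
  ultimately show ?thesis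
    using run by (simp add: sortable_def)
qed

theorem proposition6p1:
  shows "{p. is_perm p \<and> sortable p} =
    Av {[2,3,4,1], [2,5,3,1,4], [4,2,5,1,3], [4,2,5,3,1], [4,5,2,1,3],
        [4,5,2,3,1], [5,2,3,1,4], [6,4,2,1,3,5], [6,4,2,1,5,3]}"
    (is "_ = Av ?T")
proof -
  have "sortable p \<longleftrightarrow> (\<forall>t \<in> ?T. \<not> contains_pattern p t)" if "is_perm p" for p
  proof -
    have "distinct p"
      using that by (simp add: is_perm_def)
    have "sortable p \<longleftrightarrow> \<not> obstruction p"
      using that sortable_imp_no_obstruction no_obstruction_imp_sortable by blast
    also have "\<dots> \<longleftrightarrow> (\<forall>t \<in> ?T. \<not> contains_pattern p t)"
    proof (intro iffI ballI notI)
      show False if "\<not> obstruction p" "t \<in> ?T" "contains_pattern p t" for t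
        using that obstruction_mono pattern_obstruction by metis
      show False if "\<forall>t \<in> ?T. \<not> contains_pattern p t" "obstruction p"
        using contains_pattern_if_obstruction[OF \<open>distinct p\<close> that(2)] that(1) by metis
    qed
    finally show ?thesis .
  qed
  then show ?thesis
    unfolding Av_def by (intro Collect_cong conj_cong refl)
qed

end
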